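(* The following conditions are equivalent: (1) every finite connected conjugation quandle has the Hayashi property; (2) for every group $G$ and every finite conjugacy class $C$ of $G$, if $\langle C\rangle = G$, then $C$ is good in $G$.
   Context: A quandle is a nonempty set $Q$ with a binary operation $\star$ such that for each $a\in Q$ one has $a\star a=a$ and the left translation $L_a:Q\to Q$, $x\mapsto a\star x$, is an automorphism of $(Q,\star)$. It is connected if the group $\langle L_a\mid a\in Q\rangle\leq S_Q$ (where $S_Q$ is the symmetric group on $Q$) acts transitively on $Q$. A conjugation quandle over a group $G$ is a quandle $(C,\star)$ with $C\subseteq G$ and $a\star b=aba^{-1}$ for all $a,b\in C$; a conjugation quandle is a conjugation quandle over some group. A permutation of a finite nonempty set contains a regular cycle if every one of its cycle lengths (fixed points count as cycles of length 1) divides its largest cycle length. A (finite) quandle has the Hayashi property if all of its left translations contain a regular cycle. A finite conjugacy class $C$ of a group $G$ is good in $G$ if for every $c\in C$ there is $z\in C$ such that $\langle c\rangle\cap C_G(z)\leq Z(\langle C\rangle)$, where $\langle C\rangle$ is the subgroup generated by $C$, $C_G(z)$ is the centralizer of $z$ in $G$, and $Z(\cdot)$ denotes the center. *)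

theory Defs
  imports "HOL-Algebra.Group_Action" "HOL-Algebra.Generated_Groups" "HOL-Combinatorics.Cycles"
begin

text \<open>
  A quandle is given by a carrier set and a binary operation, of which only the values on the
  carrier matter.  The left translations are the extensional maps used by \<^const>\<open>Bij\<close> and
  \<^const>\<open>BijGroup\<close>, so that they are elements of the symmetric group on the carrier.
\<close>

definition left_translation :: "'a set \<Rightarrow> ('a \<Rightarrow> 'a \<Rightarrow> 'a) \<Rightarrow> 'a \<Rightarrow> 'a \<Rightarrow> 'a" where
  "left_translation Q star a = (\<lambda>x\<in>Q. star a x)"

definition quandle_automorphism ::
    "'a set \<Rightarrow> ('a \<Rightarrow> 'a \<Rightarrow> 'a) \<Rightarrow> ('a \<Rightarrow> 'a) \<Rightarrow> bool" where
  "quandle_automorphism Q star f \<longleftrightarrow>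
     f \<in> Bij Q \<and> (\<forall>x\<in>Q. \<forall>y\<in>Q. f (star x y) = star (f x) (f y))"

definition quandle :: "'a set \<Rightarrow> ('a \<Rightarrow> 'a \<Rightarrow> 'a) \<Rightarrow> bool" where
  "quandle Q star \<longleftrightarrow>
     Q \<noteq> {} \<and>
     (\<forall>a\<in>Q. \<forall>b\<in>Q. star a b \<in> Q) \<and>
     (\<forall>a\<in>Q. star a a = a) \<and>
     (\<forall>a\<in>Q. quandle_automorphism Q star (left_translation Q star a))"

definition left_mult_group :: "'a set \<Rightarrow> ('a \<Rightarrow> 'a \<Rightarrow> 'a) \<Rightarrow> ('a \<Rightarrow> 'a) monoid" where
  "left_mult_group Q star =
     (BijGroup Q)\<lparr>carrier := generate (BijGroup Q) (left_translation Q star ` Q)\<rparr>"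

definition connected_quandle :: "'a set \<Rightarrow> ('a \<Rightarrow> 'a \<Rightarrow> 'a) \<Rightarrow> bool" where
  "connected_quandle Q star \<longleftrightarrow>
     quandle Q star \<and> transitive_action (left_mult_group Q star) Q (\<lambda>g. g)"

definition conjugation_quandle_over ::
    "('a, 'b) monoid_scheme \<Rightarrow> 'a set \<Rightarrow> ('a \<Rightarrow> 'a \<Rightarrow> 'a) \<Rightarrow> bool" where
  "conjugation_quandle_over G C star \<longleftrightarrow>
     quandle C star \<and> C \<subseteq> carrier G \<and>
     (\<forall>a\<in>C. \<forall>b\<in>C. star a b = a \<otimes>\<^bsub>G\<^esub> b \<otimes>\<^bsub>G\<^esub> inv\<^bsub>G\<^esub> a)"

text \<open>
  The ambient group has its carrier in the same type as the quandle, since the quandle is literally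
  a subset of the group.  That type is a free type variable: a statement for all types covers all
  conjugation quandles.
\<close>

definition conjugation_quandle :: "'a set \<Rightarrow> ('a \<Rightarrow> 'a \<Rightarrow> 'a) \<Rightarrow> bool" where
  "conjugation_quandle C star \<longleftrightarrow>
     (\<exists>G :: 'a monoid. group G \<and> conjugation_quandle_over G C star)"

text \<open>
  If \<^term>\<open>f\<close> permutes the finite set \<^term>\<open>Q\<close> and \<^term>\<open>x \<in> Q\<close>, then
  \<^term>\<open>least_power f x\<close>, the least \<^term>\<open>n > 0\<close> with \<^term>\<open>(f ^^ n) x = x\<close>, is the
  length of the cycle of \<^term>\<open>f\<close> through \<^term>\<open>x\<close>.
\<close>

definition cycle_lengths :: "'a set \<Rightarrow> ('a \<Rightarrow> 'a) \<Rightarrow> nat set" where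
  "cycle_lengths Q f = least_power f ` Q"

definition contains_regular_cycle :: "'a set \<Rightarrow> ('a \<Rightarrow> 'a) \<Rightarrow> bool" where
  "contains_regular_cycle Q f \<longleftrightarrow> (\<forall>l\<in>cycle_lengths Q f. l dvd Max (cycle_lengths Q f))"

definition Hayashi_property :: "'a set \<Rightarrow> ('a \<Rightarrow> 'a \<Rightarrow> 'a) \<Rightarrow> bool" where
  "Hayashi_property Q star \<longleftrightarrow>
     (\<forall>a\<in>Q. contains_regular_cycle Q (left_translation Q star a))"

definition conjugacy_class :: "('a, 'b) monoid_scheme \<Rightarrow> 'a set \<Rightarrow> bool" where
  "conjugacy_class G C \<longleftrightarrow>
     (\<exists>x\<in>carrier G. C = {g \<otimes>\<^bsub>G\<^esub> x \<otimes>\<^bsub>G\<^esub> inv\<^bsub>G\<^esub> g | g. g \<in> carrier G})"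

definition centralizer :: "('a, 'b) monoid_scheme \<Rightarrow> 'a \<Rightarrow> 'a set" where
  "centralizer G z = {g \<in> carrier G. g \<otimes>\<^bsub>G\<^esub> z = z \<otimes>\<^bsub>G\<^esub> g}"

definition center :: "('a, 'b) monoid_scheme \<Rightarrow> 'a set" where
  "center G = {g \<in> carrier G. \<forall>h\<in>carrier G. g \<otimes>\<^bsub>G\<^esub> h = h \<otimes>\<^bsub>G\<^esub> g}"

definition good_in :: "('a, 'b) monoid_scheme \<Rightarrow> 'a set \<Rightarrow> bool" where
  "good_in G C \<longleftrightarrow>
     (\<forall>c\<in>C. \<exists>z\<in>C.
        generate G {c} \<inter> centralizer G z \<subseteq> center (G\<lparr>carrier := generate G C\<rparr>))"

end

theory Submission
  imports Defs
begin

text \<open>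
  For a conjugation quandle \<open>C\<close> the group generated by the left translations is the image of
  \<open>\<langle>C\<rangle>\<close> under the conjugation action, so \<open>C\<close> is connected iff it is a conjugacy class of \<open>\<langle>C\<rangle>\<close>.
  Moreover the length of the cycle of the left translation by \<open>c\<close> through \<open>x\<close> divides \<open>n\<close> iff
  \<open>c\<^sup>n\<close> commutes with \<open>x\<close>.  Hence that translation has a cycle through \<open>z\<close> whose length is a
  multiple of all the others iff every power of \<open>c\<close> that commutes with \<open>z\<close> commutes with all of
  \<open>C\<close>, that is, is central in \<open>\<langle>C\<rangle>\<close>.
\<close>

section \<open>Regular cycles and divisibility of cycle lengths\<close>

text \<open>A finite nonempty set of lengths attains its maximum, and a positive length divisible by
  all the others is that maximum. Naming a point \<open>z\<close> on the cycle removes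
  \<open>Max\<close>.\<close>

lemma contains_regular_cycle_iff:
  assumes "finite Q" and "Q \<noteq> {}" and "\<And>x. x \<in> Q \<Longrightarrow> least_power f x > 0"
  shows "contains_regular_cycle Q f \<longleftrightarrow> (\<exists>z\<in>Q. \<forall>x\<in>Q. least_power f x dvd least_power f z)"
proof
  assume "contains_regular_cycle Q f"
  moreover have "Max (cycle_lengths Q f) \<in> cycle_lengths Q f"
    using assms(1,2) by (intro Max_in) (auto simp: cycle_lengths_def)
  ultimately show "\<exists>z\<in>Q. \<forall>x\<in>Q. least_power f x dvd least_power f z"
    unfolding contains_regular_cycle_def cycle_lengths_def by fastforce
next
  assume "\<exists>z\<in>Q. \<forall>x\<in>Q. least_power f x dvd least_power f z"
  then obtain z where z: "z \<in> Q" "\<And>x. x \<in> Q \<Longrightarrow> least_power f x dvd least_power f z"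
    by blast
  then have "Max (cycle_lengths Q f) = least_power f z"
    using assms by (intro Max_eqI) (auto simp: cycle_lengths_def intro: dvd_imp_le)
  with z show "contains_regular_cycle Q f"
    by (auto simp: contains_regular_cycle_def cycle_lengths_def)
qed

section \<open>Conjugation in a group\<close>

text \<open>The restriction to \<open>C\<close> makes this an extensional map, so that it can lie in
  \<open>Bij C\<close> and equal a left translation. The index \<open>g\<close> may be any group
  element, not only one of \<open>C\<close>.\<close>

definition conj_by :: "('a, 'b) monoid_scheme \<Rightarrow> 'a set \<Rightarrow> 'a \<Rightarrow> 'a \<Rightarrow> 'a" where
  "conj_by G C g = (\<lambda>x\<in>C. g \<otimes>\<^bsub>G\<^esub> x \<otimes>\<^bsub>G\<^esub> inv\<^bsub>G\<^esub> g)"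

context group
begin

lemma conj_mult:
  assumes "g \<in> carrier G" "h \<in> carrier G" "x \<in> carrier G"
  shows "g \<otimes> h \<otimes> x \<otimes> inv (g \<otimes> h) = g \<otimes> (h \<otimes> x \<otimes> inv h) \<otimes> inv g"
  using assms by (simp add: inv_mult_group m_assoc)

lemma conj_eq_self_iff:
  assumes "g \<in> carrier G" "x \<in> carrier G"
  shows "g \<otimes> x \<otimes> inv g = x \<longleftrightarrow> g \<otimes> x = x \<otimes> g"
  using assms by (metis inv_solve_right m_closed)

lemma commute_inv:
  assumes "a \<otimes> b = b \<otimes> a" "a \<in> carrier G" "b \<in> carrier G"
  shows "inv a \<otimes> b = b \<otimes> inv a"
proof -
  have "inv a \<otimes> b = inv a \<otimes> (b \<otimes> a) \<otimes> inv a"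
    using assms(2,3) by (simp add: m_assoc)
  also have "\<dots> = inv a \<otimes> (a \<otimes> b) \<otimes> inv a"
    by (simp add: assms(1))
  also have "\<dots> = b \<otimes> inv a"
    using assms(2,3) by (simp flip: m_assoc)
  finally show ?thesis .
qed

text \<open>Integer exponents are needed because \<open>generate G {c}\<close> consists of all
  integer powers of \<open>c\<close>.\<close>

lemma commute_int_pow:
  fixes k :: int
  assumes "a \<otimes> b = b \<otimes> a" "a \<in> carrier G" "b \<in> carrier G"
  shows "a [^] k \<otimes> b = b \<otimes> a [^] k"
proof (cases "k < 0")
  case True
  have "inv (a [^] nat (- k)) \<otimes> b = b \<otimes> inv (a [^] nat (- k))"
    using assms by (intro commute_inv group_commutes_pow nat_pow_closed)
  with True show ?thesis
    by (simp only: int_pow_def2 if_True)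
next
  case False
  then show ?thesis
    using group_commutes_pow[OF assms] by (simp only: int_pow_def2 if_False)
qed

text \<open>The elements that commute with \<open>g\<close> form a subgroup, so it is enough to test
  the generators.\<close>

lemma mem_center_generated_iff:
  assumes "C \<subseteq> carrier G" "g \<in> generate G C"
  shows "g \<in> center (G\<lparr>carrier := generate G C\<rparr>) \<longleftrightarrow> (\<forall>x\<in>C. g \<otimes> x = x \<otimes> g)"
proof
  assume "g \<in> center (G\<lparr>carrier := generate G C\<rparr>)"
  then show "\<forall>x\<in>C. g \<otimes> x = x \<otimes> g"
    by (auto simp: center_def generate.incl)
next
  assume g: "\<forall>x\<in>C. g \<otimes> x = x \<otimes> g"
  have gG: "g \<in> carrier G"
    using assms generate_in_carrier by blast
  have "g \<otimes> h = h \<otimes> g" if "h \<in> generate G C" for h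
    using that
  proof induction
    case one then show ?case using gG by simp
  next
    case (incl h) then show ?case using g by blast
  next
    case (inv h)
    then show ?case
      using g gG commute_inv[of h g] assms(1) by (auto simp: subset_iff)
  next
    case (eng h1 h2)
    then have "h1 \<in> carrier G" "h2 \<in> carrier G"
      using generate_in_carrier[OF assms(1)] by auto
    then have "g \<otimes> (h1 \<otimes> h2) = h1 \<otimes> g \<otimes> h2"
      using gG eng.IH(1) by (simp flip: m_assoc)
    also have "\<dots> = h1 \<otimes> (h2 \<otimes> g)"
      using gG \<open>h1 \<in> carrier G\<close> \<open>h2 \<in> carrier G\<close> eng.IH(2) by (simp add: m_assoc)
    finally show ?case
      using gG \<open>h1 \<in> carrier G\<close> \<open>h2 \<in> carrier G\<close> by (simp add: m_assoc)
  qed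
  with assms(2) show "g \<in> center (G\<lparr>carrier := generate G C\<rparr>)"
    by (auto simp: center_def)
qed

text \<open>Conjugation by \<open>inv g\<close> also preserves \<open>C\<close> and supplies the
  inverse map, hence bijectivity; \<open>conj_mult\<close> is the homomorphism law.\<close>

lemma group_action_conj_by:
  assumes "C \<subseteq> carrier G" and closed: "\<And>g x. g \<in> carrier G \<Longrightarrow> x \<in> C \<Longrightarrow> g \<otimes> x \<otimes> inv g \<in> C"
  shows "group_action G C (conj_by G C)"
proof -
  have inv_conj: "g \<otimes> (inv g \<otimes> x \<otimes> g) \<otimes> inv g = x" "inv g \<otimes> (g \<otimes> x \<otimes> inv g) \<otimes> g = x"
    if "g \<in> carrier G" "x \<in> C" for g x
    using that assms(1) conj_mult[of g "inv g" x] conj_mult[of "inv g" g x] by auto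
  have Bij: "conj_by G C g \<in> Bij C" if g: "g \<in> carrier G" for g
  proof -
    have "bij_betw (conj_by G C g) C C"
      using g closed[of g] closed[of "inv g"] inv_conj[of g]
      by (intro bij_betw_byWitness[where f' = "conj_by G C (inv g)"])
        (auto simp: conj_by_def)
    then show ?thesis
      by (simp add: Bij_def conj_by_def)
  qed
  have "conj_by G C (g \<otimes> h) = compose C (conj_by G C g) (conj_by G C h)"
    if "g \<in> carrier G" "h \<in> carrier G" for g h
    using that assms(1) closed[of h]
    by (auto simp: conj_by_def compose_def conj_mult subset_iff intro!: restrict_ext)
  with Bij have "conj_by G C \<in> hom G (BijGroup C)"
    by (auto simp: hom_def BijGroup_def)
  then show ?thesis
    by (simp add: group_action_def group_hom_def group_hom_axioms_def group_BijGroup is_group)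
qed

section \<open>Cycle lengths and commuting powers\<close>

lemma funpow_conj_by:
  assumes "C \<subseteq> carrier G" and closed: "\<And>g x. g \<in> carrier G \<Longrightarrow> x \<in> C \<Longrightarrow> g \<otimes> x \<otimes> inv g \<in> C"
    and "c \<in> carrier G" "x \<in> C"
  shows "(conj_by G C c ^^ n) x = c [^] n \<otimes> x \<otimes> inv (c [^] n)"
proof (induction n)
  case 0 then show ?case using assms by auto
next
  case (Suc n)
  have "x \<in> carrier G" using assms by auto
  with Suc assms(3,4) closed[of "c [^] n" x] show ?case
    using conj_mult[of c "c [^] n" x] nat_pow_Suc2[of c n] by (simp add: conj_by_def)
qed

text \<open>Iterates of conjugation by \<open>c\<close> are conjugations by powers of
  \<open>c\<close>, and such a conjugation fixes \<open>x\<close> exactly when the power commutes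
  with \<open>x\<close>.\<close>

lemma
  assumes "C \<subseteq> carrier G" "finite C"
    and closed: "\<And>g x. g \<in> carrier G \<Longrightarrow> x \<in> C \<Longrightarrow> g \<otimes> x \<otimes> inv g \<in> C"
    and c: "c \<in> carrier G" and x: "x \<in> C"
  shows least_power_conj_by_pos: "least_power (conj_by G C c) x > 0"
    and least_power_conj_by_dvd_iff:
      "int (least_power (conj_by G C c) x) dvd k \<longleftrightarrow> c [^] k \<otimes> x = x \<otimes> c [^] k"
proof -
  let ?f = "conj_by G C c"
  interpret group_action G C "conj_by G C"
    using assms by (intro group_action_conj_by) auto
  have xG: "x \<in> carrier G" using assms by auto
  have pow: "(?f ^^ n) x = x \<longleftrightarrow> c [^] n \<otimes> x = x \<otimes> c [^] n" for n :: nat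
    using funpow_conj_by[OF assms(1) closed c x, of n] conj_eq_self_iff[of "c [^] n" x] c xG by simp
  have bij: "bij_betw (?f ^^ n) C C" for n
    using bij_prop0[OF c] by (intro bij_betw_funpow) (simp add: Bij_def)
  then have mem: "(?f ^^ n) x \<in> C" for n
    using x by (auto dest: bij_betwE)
  then have "range (\<lambda>n. (?f ^^ n) x) \<subseteq> C"
    by auto
  \<comment> \<open>Pigeonhole: infinitely many exponents, finitely many points of
    \<open>C\<close>.\<close>
  then have "\<not> inj (\<lambda>n. (?f ^^ n) x)"
    using assms(2) finite_subset finite_imageD infinite_UNIV_nat by blast
  then obtain i j where ij: "i < j" "(?f ^^ i) x = (?f ^^ j) x"
    unfolding inj_def by (metis linorder_neqE_nat)
  then have "(?f ^^ i) ((?f ^^ (j - i)) x) = (?f ^^ i) x"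
    using funpow_add[of i "j - i" ?f] by simp
  \<comment> \<open>Injectivity of the \<open>i\<close>-th iterate cancels it, so the orbit returns
    to \<open>x\<close> itself and \<open>least_power\<close> is a true period.\<close>
  then have "(?f ^^ (j - i)) x = x"
    using bij_betw_imp_inj_on[OF bij] mem x by (auto dest: inj_onD)
  with ij have lp: "(?f ^^ least_power ?f x) x = x" "least_power ?f x > 0"
    using least_powerI[of "j - i" ?f x] by auto
  then show "least_power ?f x > 0" by simp
  show "int (least_power ?f x) dvd k \<longleftrightarrow> c [^] k \<otimes> x = x \<otimes> c [^] k"
  proof
    assume "int (least_power ?f x) dvd k"
    then obtain m where "k = int (least_power ?f x) * m" by blast
    then have k: "c [^] k = (c [^] least_power ?f x) [^] m"
      using c by (simp add: int_pow_pow int_pow_int flip: int_pow_int)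
    show "c [^] k \<otimes> x = x \<otimes> c [^] k"
      unfolding k using lp(1) c xG by (intro commute_int_pow) (auto simp: pow)
  next
    assume *: "c [^] k \<otimes> x = x \<otimes> c [^] k"
    \<comment> \<open>Minimality of \<open>least_power\<close> concerns natural exponents, hence the
      passage to the absolute value.\<close>
    have "c [^] nat \<bar>k\<bar> \<otimes> x = x \<otimes> c [^] nat \<bar>k\<bar>"
    proof (cases "k \<ge> 0")
      case True
      then show ?thesis
        using * int_pow_int[of G c "nat k"] by simp
    next
      case False
      then have eq: "c [^] nat \<bar>k\<bar> = inv (c [^] k)"
        using int_pow_neg_int[OF c, of "nat (- k)"] c by simp
      show ?thesis
        unfolding eq using c xG by (intro commute_inv * int_pow_closed)
    qed
    then have "least_power ?f x dvd nat \<bar>k\<bar>"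
      by (intro least_power_minimal) (simp add: pow)
    then show "int (least_power ?f x) dvd k"
      by simp
  qed
qed

text \<open>For each fixed \<open>z\<close>, both conditions become statements about the exponents
  \<open>k\<close> for which \<open>c [^] k\<close> commutes with given elements of
  \<open>C\<close>, that is, about multiples of cycle lengths.\<close>

lemma contains_regular_cycle_conj_by_iff:
  assumes "C \<subseteq> carrier G" "finite C"
    and closed: "\<And>g x. g \<in> carrier G \<Longrightarrow> x \<in> C \<Longrightarrow> g \<otimes> x \<otimes> inv g \<in> C" and c: "c \<in> C"
  shows "contains_regular_cycle C (conj_by G C c) \<longleftrightarrow>
    (\<exists>z\<in>C. generate G {c} \<inter> centralizer G z \<subseteq> center (G\<lparr>carrier := generate G C\<rparr>))"
proof -
  let ?l = "least_power (conj_by G C c)"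
  have cG: "c \<in> carrier G" using assms by auto
  note dvd_iff = least_power_conj_by_dvd_iff[OF assms(1,2) closed cG]
  have "(\<forall>x\<in>C. ?l x dvd ?l z) \<longleftrightarrow>
      generate G {c} \<inter> centralizer G z \<subseteq> center (G\<lparr>carrier := generate G C\<rparr>)" if z: "z \<in> C" for z
  proof -
    \<comment> \<open>Powers of \<open>c\<close> lie in \<open>generate G C\<close>, so being
      central there amounts to commuting with all of \<open>C\<close>.\<close>
    have "generate G {c} \<subseteq> generate G C"
      using c by (intro mono_generate) auto
    then have "generate G {c} \<inter> centralizer G z \<subseteq> center (G\<lparr>carrier := generate G C\<rparr>) \<longleftrightarrow>
        (\<forall>g\<in>generate G {c}. g \<otimes> z = z \<otimes> g \<longrightarrow> (\<forall>x\<in>C. g \<otimes> x = x \<otimes> g))"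
      using mem_center_generated_iff[OF assms(1)] generate_in_carrier[OF assms(1)]
      by (fastforce simp: centralizer_def)
    also have "\<dots> \<longleftrightarrow> (\<forall>k. int (?l z) dvd k \<longrightarrow> (\<forall>x\<in>C. int (?l x) dvd k))"
      using dvd_iff z by (auto simp: generate_pow[OF cG])
    \<comment> \<open>From left to right, put \<open>k = int (?l z)\<close>; the converse is
      transitivity of divisibility.\<close>
    also have "\<dots> \<longleftrightarrow> (\<forall>x\<in>C. ?l x dvd ?l z)"
      by (meson dvd_refl dvd_trans int_dvd_int_iff)
    finally show ?thesis by blast
  qed
  moreover have "contains_regular_cycle C (conj_by G C c) \<longleftrightarrow> (\<exists>z\<in>C. \<forall>x\<in>C. ?l x dvd ?l z)"
    using assms(2) c least_power_conj_by_pos[OF assms(1,2) closed cG]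
    by (intro contains_regular_cycle_iff) auto
  ultimately show ?thesis by blast
qed

section \<open>Conjugacy classes and connectedness\<close>

text \<open>Eliminates the chosen base point of the class, which gives the form that matches
  transitivity of an action.\<close>

lemma conjugacy_class_iff:
  assumes "C \<subseteq> carrier G" and closed: "\<And>g x. g \<in> carrier G \<Longrightarrow> x \<in> C \<Longrightarrow> g \<otimes> x \<otimes> inv g \<in> C"
  shows "conjugacy_class G C \<longleftrightarrow>
    C \<noteq> {} \<and> (\<forall>x\<in>C. \<forall>y\<in>C. \<exists>g\<in>carrier G. g \<otimes> x \<otimes> inv g = y)"
proof
  assume "conjugacy_class G C"
  then obtain x where x: "x \<in> carrier G" and C: "C = {g \<otimes> x \<otimes> inv g | g. g \<in> carrier G}"
    by (auto simp: conjugacy_class_def)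
  have "x \<in> C"
    unfolding C using x by (auto intro!: exI[of _ \<one>])
  \<comment> \<open>The witness \<open>b \<otimes> inv a\<close> first undoes the conjugation by
    \<open>a\<close>, then conjugates by \<open>b\<close>.\<close>
  moreover have "\<exists>g\<in>carrier G. g \<otimes> (a \<otimes> x \<otimes> inv a) \<otimes> inv g = b \<otimes> x \<otimes> inv b"
    if "a \<in> carrier G" "b \<in> carrier G" for a b
    using that x conj_mult[of "b \<otimes> inv a" a x]
    by (intro bexI[of _ "b \<otimes> inv a"]) (simp_all add: m_assoc)
  ultimately show "C \<noteq> {} \<and> (\<forall>x\<in>C. \<forall>y\<in>C. \<exists>g\<in>carrier G. g \<otimes> x \<otimes> inv g = y)"
    unfolding C by blast
next
  assume *: "C \<noteq> {} \<and> (\<forall>x\<in>C. \<forall>y\<in>C. \<exists>g\<in>carrier G. g \<otimes> x \<otimes> inv g = y)"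
  then obtain x where "x \<in> C" by blast
  have "C = {g \<otimes> x \<otimes> inv g | g. g \<in> carrier G}"
  proof
    show "C \<subseteq> {g \<otimes> x \<otimes> inv g | g. g \<in> carrier G}"
      using * \<open>x \<in> C\<close> by fastforce
  qed (auto intro: closed \<open>x \<in> C\<close>)
  moreover have "x \<in> carrier G"
    using \<open>x \<in> C\<close> assms(1) by blast
  ultimately show "conjugacy_class G C"
    unfolding conjugacy_class_def by blast
qed

lemma conjugacy_class_closed:
  assumes "conjugacy_class G C"
  shows "C \<subseteq> carrier G" and "\<And>g x. g \<in> carrier G \<Longrightarrow> x \<in> C \<Longrightarrow> g \<otimes> x \<otimes> inv g \<in> C"
proof -
  obtain x where x: "x \<in> carrier G" and C: "C = {g \<otimes> x \<otimes> inv g | g. g \<in> carrier G}"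
    using assms by (auto simp: conjugacy_class_def)
  show "C \<subseteq> carrier G"
    unfolding C using x by auto
  show "g \<otimes> y \<otimes> inv g \<in> C" if "g \<in> carrier G" "y \<in> C" for g y
  proof -
    obtain h where "h \<in> carrier G" "y = h \<otimes> x \<otimes> inv h"
      using \<open>y \<in> C\<close> C by blast
    with that x show ?thesis
      unfolding C by (auto intro!: exI[of _ "g \<otimes> h"] simp: conj_mult)
  qed
qed

text \<open>As \<open>C\<close> generates \<open>G\<close>, the left translations generate the image
  of all of \<open>G\<close> under \<open>conj_by\<close>. Transitivity of that image means that any
  two elements of \<open>C\<close> are conjugate in \<open>G\<close>.\<close>

lemma connected_quandle_iff_conjugacy_class:
  assumes "C \<subseteq> carrier G" and gen: "generate G C = carrier G"
    and closed: "\<And>g x. g \<in> carrier G \<Longrightarrow> x \<in> C \<Longrightarrow> g \<otimes> x \<otimes> inv g \<in> C"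
    and "quandle C star" and star: "\<And>a. a \<in> C \<Longrightarrow> left_translation C star a = conj_by G C a"
  shows "connected_quandle C star \<longleftrightarrow> conjugacy_class G C"
proof -
  interpret group_action G C "conj_by G C"
    by (intro group_action_conj_by assms(1) closed)
  interpret H: group_hom G "BijGroup C" "conj_by G C"
    by (fact group_hom)
  have "left_translation C star ` C = conj_by G C ` C"
    using star by auto
  then have carrier: "carrier (left_mult_group C star) = conj_by G C ` carrier G"
    by (simp add: left_mult_group_def H.generate_img[OF assms(1)] gen)
  have "subgroup (carrier (left_mult_group C star)) (BijGroup C)"
    unfolding carrier by (rule H.img_is_subgroup)
  \<comment> \<open>A subgroup of \<open>BijGroup C\<close> acts through its inclusion, so only
    transitivity remains to be compared.\<close>
  then have "group_action (left_mult_group C star) C (\<lambda>g. g)"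
    using group_BijGroup[of C] H.H.subgroup_imp_group
    by (auto simp: group_action_def group_hom_def group_hom_axioms_def hom_def left_mult_group_def
        dest: subgroup.mem_carrier)
  then have "transitive_action (left_mult_group C star) C (\<lambda>g. g) \<longleftrightarrow>
      (\<forall>x\<in>C. \<forall>y\<in>C. \<exists>g\<in>carrier G. g \<otimes> x \<otimes> inv g = y)"
    by (auto simp: transitive_action_def transitive_action_axioms_def carrier conj_by_def)
  then show ?thesis
    using assms(4) conjugacy_class_iff[OF assms(1) closed]
    by (auto simp: connected_quandle_def quandle_def)
qed

section \<open>Conjugation quandles\<close>

text \<open>Closure of the quandle operation settles the generators; their inverses need that left
  translations are onto, since \<open>C\<close> itself need not be closed under inverses.\<close>

lemma conj_generated_closed:
  assumes "conjugation_quandle_over G C star" and "g \<in> generate G C" and "x \<in> C"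
  shows "g \<otimes> x \<otimes> inv g \<in> C"
  using assms(2,3)
proof (induction arbitrary: x)
  case one
  then show ?case using assms(1) by (auto simp: conjugation_quandle_over_def)
next
  case (incl a)
  then show ?case using assms(1) by (metis conjugation_quandle_over_def quandle_def)
next
  case (inv a)
  have C: "C \<subseteq> carrier G" and star: "\<And>b. b \<in> C \<Longrightarrow> star a b = a \<otimes> b \<otimes> inv a"
    using assms(1) inv by (auto simp: conjugation_quandle_over_def)
  have "bij_betw (left_translation C star a) C C"
    using assms(1) inv
    by (auto simp: conjugation_quandle_over_def quandle_def quandle_automorphism_def Bij_def)
  then obtain y where y: "y \<in> C" "x = left_translation C star a y"
    using inv by (auto simp: bij_betw_def)
  then have "x = a \<otimes> y \<otimes> inv a"
    by (simp add: left_translation_def star)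
  then have "inv a \<otimes> x \<otimes> inv (inv a) = y"
    using conj_mult[of "inv a" a y] C inv y by (auto simp: subset_iff)
  with y show ?case by simp
next
  case (eng g h)
  have C: "C \<subseteq> carrier G"
    using assms(1) by (auto simp: conjugation_quandle_over_def)
  show ?case
    using eng conj_mult[of g h x] generate_in_carrier[OF C] C by auto
qed

lemma quandle_conj:
  assumes "C \<subseteq> carrier G" "C \<noteq> {}"
    and closed: "\<And>g x. g \<in> carrier G \<Longrightarrow> x \<in> C \<Longrightarrow> g \<otimes> x \<otimes> inv g \<in> C"
  shows "quandle C (\<lambda>a b. a \<otimes> b \<otimes> inv a)"
proof -
  let ?star = "\<lambda>a b. a \<otimes> b \<otimes> inv a"
  interpret group_action G C "conj_by G C"
    by (intro group_action_conj_by assms(1) closed)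
  have star_distrib: "?star a (?star x y) = ?star (?star a x) (?star a y)"
    if "a \<in> carrier G" "x \<in> carrier G" "y \<in> carrier G" for a x y
  proof -
    \<comment> \<open>Conjugating by \<open>a\<close> and then by \<open>?star a x\<close> is
      conjugating by the product \<open>?star a x \<otimes> a\<close>, which collapses to
      \<open>a \<otimes> x\<close>.\<close>
    have "?star (?star a x) (?star a y) = ?star (?star a x \<otimes> a) y"
      using that by (intro conj_mult[symmetric]) auto
    also have "?star a x \<otimes> a = a \<otimes> x"
      using that by (simp add: m_assoc)
    finally show ?thesis
      using that by (simp add: conj_mult)
  qed
  have "quandle_automorphism C ?star (left_translation C ?star a)" if "a \<in> C" for a
  proof -
    have "left_translation C ?star a = conj_by G C a"
      by (simp add: left_translation_def conj_by_def)
    with that assms bij_prop0[of a] star_distrib[of a] show ?thesis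
      by (auto simp: quandle_automorphism_def conj_by_def subset_iff)
  qed
  moreover have "?star a a = a" if "a \<in> C" for a
    using that assms(1) by (auto simp: m_assoc)
  ultimately show ?thesis
    using assms by (auto simp: quandle_def)
qed

end

section \<open>Equivalence of the two conditions\<close>

text \<open>Both directions keep the set \<open>C\<close> and change only the structure around it,
  so the equivalence holds for each type separately.\<close>

theorem theorem4p1:
  shows "(\<forall>(C :: 'a set) star.
            finite C \<and> conjugation_quandle C star \<and> connected_quandle C star
              \<longrightarrow> Hayashi_property C star)
         \<longleftrightarrow>
         (\<forall>(G :: 'a monoid) C.
            group G \<and> finite C \<and> conjugacy_class G C \<and> generate G C = carrier G
              \<longrightarrow> good_in G C)"
proof (intro iffI allI impI)
  fix G :: "'a monoid" and C
  assume Hayashi: "\<forall>(C :: 'a set) star.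
      finite C \<and> conjugation_quandle C star \<and> connected_quandle C star \<longrightarrow> Hayashi_property C star"
    and *: "group G \<and> finite C \<and> conjugacy_class G C \<and> generate G C = carrier G"
  then interpret group G by blast
  \<comment> \<open>With conjugation in \<open>G\<close> as the operation, being a class of the
    group that \<open>C\<close> generates gives connectedness.\<close>
  define star where "star = (\<lambda>a b. a \<otimes>\<^bsub>G\<^esub> b \<otimes>\<^bsub>G\<^esub> inv\<^bsub>G\<^esub> a)"
  have lt: "left_translation C star a = conj_by G C a" for a
    by (simp add: left_translation_def conj_by_def star_def)
  note C = conjugacy_class_closed[of C]
  have "C \<noteq> {}"
    using * conjugacy_class_iff[of C] C by blast
  then have quandle: "quandle C star"
    unfolding star_def using * C by (intro quandle_conj) auto
  then have "connected_quandle C star"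
    using * C lt by (subst connected_quandle_iff_conjugacy_class) auto
  moreover have "conjugation_quandle C star"
    using * C(1) quandle is_group
    by (auto simp: conjugation_quandle_def conjugation_quandle_over_def star_def)
  ultimately have "Hayashi_property C star"
    using Hayashi * by blast
  then show "good_in G C"
    using * C contains_regular_cycle_conj_by_iff[of C]
    by (auto simp: Hayashi_property_def good_in_def lt)
next
  fix C :: "'a set" and star
  assume good: "\<forall>(G :: 'a monoid) C.
      group G \<and> finite C \<and> conjugacy_class G C \<and> generate G C = carrier G \<longrightarrow> good_in G C"
    and *: "finite C \<and> conjugation_quandle C star \<and> connected_quandle C star"
  then obtain G :: "'a monoid" where "group G" and over: "conjugation_quandle_over G C star"
    by (auto simp: conjugation_quandle_def)
  interpret group G by fact
  \<comment> \<open>Elements of \<open>G\<close> outside \<open>generate G C\<close> need not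
    preserve \<open>C\<close> under conjugation, so the ambient group is cut down to the part that
    connectedness sees.\<close>
  define H where "H = G\<lparr>carrier := generate G C\<rparr>"
  have C: "C \<subseteq> carrier G" and quandle: "quandle C star"
    using over by (auto simp: conjugation_quandle_over_def)
  note subgroup = generate_is_subgroup[OF C]
  interpret H: group H
    unfolding H_def by (rule subgroup_imp_group[OF subgroup])
  have CH: "C \<subseteq> carrier H"
    by (auto simp: H_def generate.incl)
  have conj: "g \<otimes>\<^bsub>H\<^esub> x \<otimes>\<^bsub>H\<^esub> inv\<^bsub>H\<^esub> g = g \<otimes>\<^bsub>G\<^esub> x \<otimes>\<^bsub>G\<^esub> inv\<^bsub>G\<^esub> g" if "g \<in> carrier H" for g x
    using that m_inv_consistent[OF subgroup] by (simp add: H_def)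
  have closed: "g \<otimes>\<^bsub>H\<^esub> x \<otimes>\<^bsub>H\<^esub> inv\<^bsub>H\<^esub> g \<in> C" if "g \<in> carrier H" "x \<in> C" for g x
    using conj_generated_closed[OF over _ that(2), of g] that by (simp add: conj) (simp add: H_def)
  have gen: "generate H C = carrier H"
    using generate_consistent[OF _ subgroup, of C] by (simp add: H_def generate.incl subsetI)
  \<comment> \<open>The operation \<open>star\<close> is known only on \<open>C\<close>; both maps
    are restricted to \<open>C\<close>, so they agree as functions.\<close>
  have lt: "left_translation C star a = conj_by H C a" if "a \<in> C" for a
    using that over CH
    by (auto simp: left_translation_def conj_by_def conj conjugation_quandle_over_def subset_iff
        intro!: restrict_ext)
  have "conjugacy_class H C"
    using H.connected_quandle_iff_conjugacy_class[OF CH gen closed quandle lt] * by blast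
  with * gen good H.is_group have "good_in H C"
    by blast
  then show "Hayashi_property C star"
    using * H.contains_regular_cycle_conj_by_iff[OF CH _ closed]
    by (auto simp: Hayashi_property_def good_in_def lt)
qed

end
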